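(* Let $c=1/2-\varepsilon(n)$ where $n^{-1/3}\ll\varepsilon(n)<1/2$. Then $$f_{\mathrm{cut}}(n,\lfloor cn\rfloor)=\lfloor cn\rfloor-\Theta(\ln(1/\varepsilon))+\Theta(1).$$
   Context: $G(n,m)$ denotes a uniformly random graph on $n$ vertices with $m$ edges. For a graph $G$, $\max\operatorname{cut}(G)$ is the maximum, over partitions of the vertex set into two parts, of the number of edges with one endpoint in each part; $f_{\mathrm{cut}}(n,m)=\mathbb{E}[\max\operatorname{cut}(G(n,m))]$. The notation $a(n)\ll b(n)$ means $a(n)/b(n)\to0$. *)

theory Defs
  imports "HOL-Probability.Probability" "HOL-Library.Landau_Symbols"
begin

definition all_edges :: "'a set \<Rightarrow> 'a set set" where
  "all_edges V = {e. e \<subseteq> V \<and> card e = 2}"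

definition graphs_nm :: "nat \<Rightarrow> nat \<Rightarrow> nat set set set" where
  "graphs_nm n m = {E. E \<subseteq> all_edges {..<n} \<and> card E = m}"

(* pmf_of_set is only meaningful on nonempty sets, i.e. for m \<le> n choose 2. *)
definition G_nm :: "nat \<Rightarrow> nat \<Rightarrow> nat set set pmf" where
  "G_nm n m = pmf_of_set (graphs_nm n m)"

definition cut_edges :: "'a set \<Rightarrow> 'a set set \<Rightarrow> 'a set \<Rightarrow> 'a set set" where
  "cut_edges V E S = {e \<in> E. \<exists>u \<in> S. \<exists>v \<in> V - S. e = {u, v}}"

(* A partition of V into two parts is given by one part S; a part may be empty. *)
definition max_cut :: "'a set \<Rightarrow> 'a set set \<Rightarrow> nat" where
  "max_cut V E = Max ((\<lambda>S. card (cut_edges V E S)) ` Pow V)"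

definition f_cut :: "nat \<Rightarrow> nat \<Rightarrow> real" where
  "f_cut n m = measure_pmf.expectation (G_nm n m) (\<lambda>E. real (max_cut {..<n} E))"

lemma finite_all_edges: "finite V \<Longrightarrow> finite (all_edges V)"
  by (rule finite_subset[of _ "Pow V"]) (auto simp: all_edges_def)

lemma card_all_edges: "finite V \<Longrightarrow> card (all_edges V) = card V choose 2"
  unfolding all_edges_def by (rule n_subsets)

lemma finite_graphs_nm: "finite (graphs_nm n m)"
  by (rule finite_subset[of _ "Pow (all_edges {..<n})"])
     (auto simp: graphs_nm_def finite_all_edges)

lemma graphs_nm_nonempty: "m \<le> n choose 2 \<Longrightarrow> graphs_nm n m \<noteq> {}"
  using obtain_subset_with_card_n[of m "all_edges {..<n}"]
  by (auto simp: graphs_nm_def card_all_edges)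

end

theory Submission
  imports Defs
begin

text \<open>
  Let X be the number of edges minus the maximum cut; it suffices that
  ln (1/\<epsilon>) / 8 - 1 \<le> E X \<le> ln (1/\<epsilon>), as then h = 1 and g = E X + 1 work.

  Upper bound: X is at most the number of cycles, since edges that close no cycle can be cut
  greedily. The expected number of cycles of length k is at most (1 - \<epsilon>)^k / k, and these sum to
  at most ln (1/\<epsilon>).

  Lower bound: every odd cycle contains an uncut edge. Discard the odd cycles of length at most L
  that have an ear (a path of length at most L between two of their vertices, edge-disjoint from
  them); the remaining ones are pairwise edge-disjoint, so X is at least their number. For
  L of order 1/\<epsilon>, the expected number of odd cycles is of order ln (1/\<epsilon>), while ears cost only
  L^3/n, which is bounded because \<epsilon> exceeds n^(-1/3).
\<close>

section \<open>Cycles and ears\<close>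

fun path_edges :: "'a list \<Rightarrow> 'a set set" where
  "path_edges (a # b # xs) = insert {a, b} (path_edges (b # xs))"
| "path_edges _ = {}"

text \<open>Appending the head adds the closing edge. A list of two vertices gives a single edge, so
  proper cycles begin at length 3.\<close>

definition cycle_edges :: "'a list \<Rightarrow> 'a set set" where
  "cycle_edges xs = path_edges (xs @ [hd xs])"

text \<open>Cycles are listed with a starting vertex and an orientation, so a cycle of length
  k is counted 2k times.\<close>

definition cycles :: "'a set \<Rightarrow> 'a set set \<Rightarrow> nat \<Rightarrow> 'a list set" where
  "cycles V E k =
     {xs. length xs = k \<and> distinct xs \<and> set xs \<subseteq> V \<and> cycle_edges xs \<subseteq> E}"

text \<open>An ear leaves the cycle at its first vertex, so that there are only k choices of its ends.\<close>

definition ears :: "'a set \<Rightarrow> 'a set set \<Rightarrow> nat \<Rightarrow> nat \<Rightarrow> ('a list \<times> nat \<times> 'a list) set" where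
  "ears V E k q =
     {(xs, j, ys). xs \<in> cycles V E k \<and> j < k \<and> length ys = q \<and> set ys \<subseteq> V \<and>
        distinct (hd xs # ys @ [xs ! j]) \<and>
        path_edges (hd xs # ys @ [xs ! j]) \<subseteq> E - cycle_edges xs}"

definition uncut_edges :: "'a set \<Rightarrow> 'a set set \<Rightarrow> 'a set \<Rightarrow> 'a set set" where
  "uncut_edges V E S = E - cut_edges V E S"

section \<open>Edge counts and rotations of paths and cycles\<close>

lemma path_edges_append:
  "path_edges (xs @ a # ys) = path_edges (xs @ [a]) \<union> path_edges (a # ys)"
  by (induction xs rule: path_edges.induct) auto

lemma finite_path_edges [simp]: "finite (path_edges xs)"
  by (induction xs rule: path_edges.induct) auto

lemma path_edges_subset: "e \<in> path_edges xs \<Longrightarrow> e \<subseteq> set xs"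
  by (induction xs rule: path_edges.induct) auto

lemma card_path_edges: "distinct xs \<Longrightarrow> card (path_edges xs) = length xs - 1"
proof (induction xs rule: path_edges.induct)
  case (1 a b xs)
  then have "{a, b} \<notin> path_edges (b # xs)"
    by (auto dest: path_edges_subset)
  with 1 show ?case by simp
qed auto

lemma cycle_edges_Cons: "cycle_edges (a # xs) = path_edges (a # xs @ [a])"
  by (simp add: cycle_edges_def)

lemma finite_cycle_edges [simp]: "finite (cycle_edges xs)"
  by (simp add: cycle_edges_def)

lemma cycle_edges_rotate1: "cycle_edges (rotate1 xs) = cycle_edges xs"
proof (cases xs rule: path_edges.cases)
  case (1 a b ys)
  then show ?thesis
    using path_edges_append[of "b # ys" a "[b]"] by (auto simp: cycle_edges_def)
qed (auto simp: cycle_edges_def)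

lemma cycle_edges_rotate: "cycle_edges (rotate i xs) = cycle_edges xs"
  by (induction i) (auto simp: cycle_edges_rotate1)

lemma cycles_rotate: "xs \<in> cycles V E k \<Longrightarrow> rotate i xs \<in> cycles V E k"
  by (auto simp: cycles_def cycle_edges_rotate)

text \<open>The closing edge is new: among the path edges only the first, \<open>{a, b}\<close>,
  contains the starting vertex \<open>a\<close>, and length at least 3 makes \<open>b\<close> differ
  from the last vertex \<open>z\<close>.\<close>

lemma card_cycle_edges:
  assumes "distinct xs" "length xs \<ge> 3"
  shows "card (cycle_edges xs) = length xs"
proof -
  obtain a b c ys where xs: "xs = a # b # c # ys"
    using assms(2) by (auto simp: numeral_3_eq_3 Suc_le_length_iff)
  define zs where "zs = butlast (c # ys)"
  define z where "z = last (c # ys)"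
  have cys: "c # ys = zs @ [z]" by (simp add: zs_def z_def)
  have xs': "xs = a # b # zs @ [z]" by (simp add: xs cys)
  have "cycle_edges xs = insert {z, a} (path_edges xs)"
    using path_edges_append[of "a # b # zs" z "[a]"] by (simp add: cycle_edges_def xs')
  moreover have "{z, a} \<notin> path_edges xs"
  proof
    assume "{z, a} \<in> path_edges xs"
    then have "{z, a} = {a, b} \<or> {z, a} \<in> path_edges (b # zs @ [z])"
      by (simp add: xs')
    moreover have "{z, a} \<noteq> {a, b}"
      using assms(1) by (auto simp: xs' doubleton_eq_iff)
    moreover have "{z, a} \<notin> path_edges (b # zs @ [z])"
      using assms(1) path_edges_subset[of "{z, a}" "b # zs @ [z]"] by (auto simp: xs')
    ultimately show False by simp
  qed
  ultimately show ?thesis using assms by (simp add: card_path_edges)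
qed

lemma path_edges_subset_all_edges:
  "distinct xs \<Longrightarrow> set xs \<subseteq> V \<Longrightarrow> path_edges xs \<subseteq> all_edges V"
  by (induction xs rule: path_edges.induct) (auto simp: all_edges_def)

lemma cycle_edges_subset_all_edges:
  assumes "distinct xs" "length xs \<ge> 2" "set xs \<subseteq> V"
  shows "cycle_edges xs \<subseteq> all_edges V"
proof -
  obtain a b ys where xs: "xs = a # b # ys"
    using assms(2) by (auto simp: numeral_2_eq_2 Suc_le_length_iff)
  have "cycle_edges xs = insert {a, b} (path_edges (b # ys @ [a]))"
    by (simp add: cycle_edges_def xs)
  with path_edges_subset_all_edges[of "b # ys @ [a]" V] assms show ?thesis by (auto simp: xs all_edges_def)
qed

lemma finite_lists_distinct:
  assumes "finite V" shows "finite {xs. length xs = k \<and> distinct xs \<and> set xs \<subseteq> V}"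
  by (rule finite_subset[OF _ finite_lists_length_eq[OF assms, of k]]) auto

lemma finite_cycles: "finite V \<Longrightarrow> finite (cycles V E k)"
  by (rule finite_subset[OF _ finite_lists_length_eq[of V k]]) (auto simp: cycles_def)

lemma finite_ears:
  assumes "finite V" shows "finite (ears V E k q)"
proof (rule finite_subset)
  show "ears V E k q \<subseteq>
      cycles V E k \<times> {..<k} \<times> {ys. set ys \<subseteq> V \<and> length ys = q}"
    by (auto simp: ears_def)
  show "finite (cycles V E k \<times> {..<k} \<times> {ys. set ys \<subseteq> V \<and> length ys = q})"
    using assms by (auto intro: finite_cycles finite_lists_length_eq)
qed

text \<open>A list of length \<open>k\<close> has at most \<open>k\<close> rotations, so each
  element of \<open>B\<close> serves at most \<open>k\<close> elements of \<open>A\<close>.\<close>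

lemma card_le_rotations:
  assumes "finite B" "k > 0" "\<And>xs. xs \<in> A \<Longrightarrow> length xs = k"
    and "\<And>xs. xs \<in> A \<Longrightarrow> \<exists>i. rotate i xs \<in> B"
  shows "card A \<le> k * card B"
proof -
  have "A \<subseteq> (\<lambda>(i, xs). rotate i xs) ` ({1..k} \<times> B)"
  proof
    fix xs assume "xs \<in> A"
    with assms obtain i where i: "rotate i xs \<in> B" and l: "length xs = k" by blast
    \<comment> \<open>Another \<open>k - i mod k\<close> rotations complete a full turn; this number
      lies in \<open>{1..k}\<close>, hence that index set.\<close>
    have "rotate (k - i mod k) (rotate i xs) = rotate (k - i mod k + i mod k) xs"
      using l by (metis rotate_conv_mod rotate_rotate)
    also have "\<dots> = xs" using l \<open>k > 0\<close> by (simp add: less_imp_le)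
    finally show "xs \<in> (\<lambda>(i, xs). rotate i xs) ` ({1..k} \<times> B)"
      using i \<open>k > 0\<close> by (intro image_eqI[of _ _ "(k - i mod k, rotate i xs)"]) (auto simp: Suc_le_eq)
  qed
  then have "card A \<le> card ((\<lambda>(i, xs). rotate i xs) ` ({1..k} \<times> B))"
    using assms(1) by (intro card_mono) auto
  also have "\<dots> \<le> card ({1..k} \<times> B)" using assms(1) by (intro card_image_le) auto
  finally show ?thesis by (simp add: card_cartesian_product)
qed

section \<open>Maximum cuts and the number of cycles\<close>

lemma cut_edges_iff:
  assumes "E \<subseteq> all_edges V" "{a, b} \<in> E"
  shows "{a, b} \<in> cut_edges V E S \<longleftrightarrow> (a \<in> S) \<noteq> (b \<in> S)"
proof -
  from assms have "{a, b} \<subseteq> V" by (auto simp: all_edges_def)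
  with assms(2) show ?thesis unfolding cut_edges_def
    by (auto simp: doubleton_eq_iff)
qed

lemma uncut_edges_iff:
  assumes "E \<subseteq> all_edges V"
  shows "{a, b} \<in> uncut_edges V E S \<longleftrightarrow> {a, b} \<in> E \<and> (a \<in> S \<longleftrightarrow> b \<in> S)"
  using cut_edges_iff[OF assms, of a b S] by (auto simp: uncut_edges_def)

lemma edge_cases:
  assumes "E \<subseteq> all_edges V" "e \<in> E"
  obtains a b where "e = {a, b}" "a \<noteq> b" "a \<in> V" "b \<in> V"
  using assms by (auto simp: all_edges_def card_2_iff subset_iff)

lemma card_uncut_edges:
  assumes "finite E"
  shows "card (cut_edges V E S) + card (uncut_edges V E S) = card E"
proof -
  have "cut_edges V E S \<subseteq> E" by (auto simp: cut_edges_def)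
  with assms show ?thesis unfolding uncut_edges_def
    by (simp add: card_Diff_subset card_mono finite_subset)
qed

text \<open>Induction along the walk: a new vertex extends the path, and a vertex met before
  truncates the path at its occurrence, so the vertices stay distinct.\<close>

lemma rtrancl_imp_path:
  assumes "(u, v) \<in> {(a, b). {a, b} \<in> E}\<^sup>*" "u \<in> V" "E \<subseteq> all_edges V"
  shows "\<exists>p. p \<noteq> [] \<and> hd p = u \<and> last p = v \<and> distinct p \<and> set p \<subseteq> V \<and> path_edges p \<subseteq> E"
  using assms(1)
proof (induction rule: rtrancl_induct)
  case base
  then show ?case using assms(2) by (intro exI[of _ "[u]"]) auto
next
  case (step y z)
  then obtain p where p: "p \<noteq> []" "hd p = u" "last p = y" "distinct p" "set p \<subseteq> V"
      "path_edges p \<subseteq> E" by blast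
  have z: "{y, z} \<in> E" "z \<in> V" using step(2) assms(3) by (auto simp: all_edges_def)
  show ?case
  proof (cases "z \<in> set p")
    case True
    then obtain p1 p2 where p12: "p = p1 @ z # p2" by (auto dest: split_list)
    show ?thesis
      using p by (intro exI[of _ "p1 @ [z]"])
        (auto simp: p12 hd_append path_edges_append[of p1 z p2])
  next
    case False
    define p' where "p' = butlast p"
    have p': "p = p' @ [y]" using p(1,3) append_butlast_last_id[of p] by (simp add: p'_def)
    show ?thesis
      using p z False by (intro exI[of _ "p @ [z]"])
        (auto simp: p' hd_append path_edges_append[of p' y "[z]"])
  qed
qed

lemma cycles_mono: "E \<subseteq> E' \<Longrightarrow> cycles V E k \<subseteq> cycles V E' k"
  by (auto simp: cycles_def)

text \<open>The \<open>k\<close> rotations of \<open>p\<close> are different lists and all use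
  \<open>e\<close>, so none of them was a cycle before \<open>e\<close> was added.\<close>

lemma card_cycles_insert:
  assumes "finite V" "p \<in> cycles V (insert e E) k" "e \<in> cycle_edges p" "e \<notin> E"
  shows "card (cycles V E k) + k \<le> card (cycles V (insert e E) k)"
proof -
  let ?R = "(\<lambda>i. rotate i p) ` {..<k}"
  have p: "length p = k" "distinct p" using assms(2) by (auto simp: cycles_def)
  have inj: "inj_on (\<lambda>i. rotate i p) {..<k}"
  proof (rule inj_onI)
    fix i j assume ij: "i \<in> {..<k}" "j \<in> {..<k}" "rotate i p = rotate j p"
    then have "p \<noteq> []" using p by auto
    then have "p ! i = p ! j"
      using ij p hd_rotate_conv_nth[of p i] hd_rotate_conv_nth[of p j] by simp
    then show "i = j" using ij p by (simp add: nth_eq_iff_index_eq)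
  qed
  have "cycles V E k \<union> ?R \<subseteq> cycles V (insert e E) k"
    using assms(2) cycles_mono[of E "insert e E" V k] by (auto intro: cycles_rotate)
  then have "card (cycles V E k \<union> ?R) \<le> card (cycles V (insert e E) k)"
    using assms(1) by (intro card_mono finite_cycles)
  moreover have "cycles V E k \<inter> ?R = {}"
    using assms(3,4) by (auto simp: cycles_def cycle_edges_rotate)
  then have "card (cycles V E k \<union> ?R) = card (cycles V E k) + k"
    using assms(1) inj by (subst card_Un_disjoint) (auto simp: finite_cycles card_image)
  ultimately show ?thesis by simp
qed

text \<open>Greedy choice of the part: an edge closing no cycle joins two components, and complementing
  the part on one of them cuts that edge without affecting the others.\<close>

lemma exists_cut_le_cycles:
  assumes "finite V" "E \<subseteq> all_edges V"
  shows "\<exists>S\<subseteq>V. real (card (uncut_edges V E S)) \<le> (\<Sum>k=3..card V. card (cycles V E k) / k)"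
proof -
  have "finite E" using assms finite_all_edges finite_subset by blast
  then show ?thesis using assms(2)
  proof (induction E rule: finite_induct)
    case empty
    then show ?case by (auto simp: uncut_edges_def intro!: sum_nonneg exI[of _ "{}"])
  next
    case (insert e F)
    then have F: "F \<subseteq> all_edges V" by auto
    with insert obtain S where S: "S \<subseteq> V"
      "real (card (uncut_edges V F S)) \<le> (\<Sum>k=3..card V. card (cycles V F k) / k)" by blast
    obtain u v where uv: "e = {u, v}" "u \<noteq> v" "u \<in> V" "v \<in> V"
      using insert.prems by (rule edge_cases) auto
    define R where "R = {(a, b). {a, b} \<in> F}"
    have mono: "card (cycles V F k) \<le> card (cycles V (insert e F) k)" for k
      using assms(1) by (intro card_mono finite_cycles cycles_mono) auto
    have fin: "finite (uncut_edges V F S)"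
      using insert.hyps by (simp add: uncut_edges_def)
    show ?case
    proof (cases "(u, v) \<in> R\<^sup>*")
      \<comment> \<open>Here \<open>e\<close> closes a cycle with a path in \<open>F\<close>.
        Keeping \<open>S\<close> costs at most one more uncut edge, which the
        \<open>length p\<close> new rotations pay for in the sum.\<close>
      case True
      then obtain p where p: "p \<noteq> []" "hd p = u" "last p = v" "distinct p" "set p \<subseteq> V"
          "path_edges p \<subseteq> F"
        using rtrancl_imp_path[of u v F V] F uv unfolding R_def by blast
      define p' where "p' = butlast p"
      have p': "p = p' @ [v]" using p(1,3) append_butlast_last_id[of p] by (simp add: p'_def)
      have cyc: "cycle_edges p = insert e (path_edges p)"
        using path_edges_append[of p' v "[u]"] p(2) uv by (auto simp: cycle_edges_def p')
      \<comment> \<open>A path on \<open>u\<close> and \<open>v\<close> alone would be the edge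
        \<open>e\<close> itself, which is not in \<open>F\<close>.\<close>
      have "length p \<ge> 3"
      proof (rule ccontr)
        assume "\<not> length p \<ge> 3"
        then have "p' = [u]" using p(2) uv by (cases p') (auto simp: p' Suc_le_eq)
        then show False using p(6) insert.hyps uv by (auto simp: p')
      qed
      moreover have "length p \<le> card V"
        using p assms(1) by (metis card_mono distinct_card)
      ultimately have l: "length p \<in> {3..card V}" by simp
      have "p \<in> cycles V (insert e F) (length p)"
        using p cyc by (auto simp: cycles_def)
      then have "card (cycles V F (length p)) + length p \<le> card (cycles V (insert e F) (length p))"
        using assms(1) insert.hyps cyc by (intro card_cycles_insert) auto
      then have "real (card (cycles V F (length p))) + length p \<le> card (cycles V (insert e F) (length p))"
        by linarith
      then have "(card (cycles V F (length p)) + real (length p)) / length p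
          \<le> card (cycles V (insert e F) (length p)) / length p"
        by (intro divide_right_mono) auto
      then have step: "card (cycles V F (length p)) / length p + 1
          \<le> card (cycles V (insert e F) (length p)) / length p"
        using p(1) by (simp add: add_divide_distrib)
      have "uncut_edges V (insert e F) S \<subseteq> insert e (uncut_edges V F S)"
        by (auto simp: uncut_edges_def cut_edges_def)
      then have "card (uncut_edges V (insert e F) S) \<le> card (insert e (uncut_edges V F S))"
        using fin by (intro card_mono) auto
      also have "\<dots> \<le> card (uncut_edges V F S) + 1"
        using fin by (simp add: card_insert_if)
      finally have "real (card (uncut_edges V (insert e F) S))
          \<le> (\<Sum>k=3..card V. card (cycles V F k) / k) + 1" using S(2) by linarith
      \<comment> \<open>The additional 1 is charged to the term for \<open>length p\<close>; the
        other terms can only grow.\<close>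
      also have "\<dots> = (\<Sum>k\<in>{3..card V} - {length p}. card (cycles V F k) / k)
           + (card (cycles V F (length p)) / length p + 1)"
        using l by (subst sum.remove[of _ "length p"]) auto
      also have "\<dots> \<le> (\<Sum>k\<in>{3..card V} - {length p}. card (cycles V (insert e F) k) / k)
           + card (cycles V (insert e F) (length p)) / length p"
        using step mono by (intro add_mono sum_mono divide_right_mono) auto
      also have "\<dots> = (\<Sum>k=3..card V. card (cycles V (insert e F) k) / k)"
        using l by (subst (2) sum.remove[of _ "length p"]) auto
      finally show ?thesis using S(1) by blast
    next
      case False
      \<comment> \<open>The component of \<open>u\<close> in \<open>F\<close>: every edge of
        \<open>F\<close> has both ends in it or neither.\<close>
      define K where "K = {w. (u, w) \<in> R\<^sup>*}"
      have K: "a \<in> K \<longleftrightarrow> b \<in> K" if "{a, b} \<in> F" for a b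
      proof -
        have "(a, b) \<in> R" "(b, a) \<in> R" using that by (auto simp: R_def insert_commute)
        then show ?thesis by (auto simp: K_def intro: rtrancl_into_rtrancl)
      qed
      have uK: "u \<in> K" "v \<notin> K" using False by (auto simp: K_def)
      \<comment> \<open>The flip happens only if \<open>S\<close> leaves \<open>e\<close> uncut.
        Intersecting \<open>K\<close> with \<open>V\<close> makes \<open>T \<subseteq> V\<close>
        immediate.\<close>
      define T where "T = (if (u \<in> S) = (v \<in> S) then (S - K) \<union> (V \<inter> K - S) else S)"
      have T: "T \<subseteq> V" using S by (auto simp: T_def)
      have "uncut_edges V (insert e F) T \<subseteq> uncut_edges V F S"
      proof
        fix d assume d: "d \<in> uncut_edges V (insert e F) T"
        then have "d \<in> insert e F" by (simp add: uncut_edges_def)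
        with insert.prems obtain a b where ab: "d = {a, b}" "a \<in> V" "b \<in> V"
          by (rule edge_cases)
        have "(a \<in> T) = (b \<in> T)" "d \<in> insert e F"
          using d uncut_edges_iff[OF insert.prems, of a b T] ab by auto
        moreover have "(u \<in> T) \<noteq> (v \<in> T)" using uK uv by (auto simp: T_def)
        ultimately have "d \<in> F" using ab uv by (auto simp: doubleton_eq_iff)
        moreover have "(a \<in> S) = (b \<in> S)"
          using \<open>(a \<in> T) = (b \<in> T)\<close> K[of a b] \<open>d \<in> F\<close> ab by (auto simp: T_def split: if_splits)
        ultimately show "d \<in> uncut_edges V F S" using uncut_edges_iff[OF F] ab by simp
      qed
      then have "card (uncut_edges V (insert e F) T) \<le> card (uncut_edges V F S)"
        using fin by (intro card_mono)
      then have "real (card (uncut_edges V (insert e F) T))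
          \<le> (\<Sum>k=3..card V. card (cycles V F k) / k)" using S(2) by linarith
      also have "\<dots> \<le> (\<Sum>k=3..card V. card (cycles V (insert e F) k) / k)"
        using mono by (intro sum_mono divide_right_mono) auto
      finally show ?thesis using T by blast
    qed
  qed
qed

lemma card_edges_minus_max_cut_le:
  assumes "finite V" "E \<subseteq> all_edges V"
  shows "real (card E) - max_cut V E \<le> (\<Sum>k=3..card V. card (cycles V E k) / k)"
proof -
  obtain S where S: "S \<subseteq> V"
    "real (card (uncut_edges V E S)) \<le> (\<Sum>k=3..card V. card (cycles V E k) / k)"
    using exists_cut_le_cycles[OF assms] by blast
  have "finite E" using assms finite_all_edges finite_subset by blast
  then have "card (cut_edges V E S) + card (uncut_edges V E S) = card E"
    by (rule card_uncut_edges)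
  moreover have "card (cut_edges V E S) \<le> max_cut V E"
    unfolding max_cut_def using assms(1) S(1) by (intro Max_ge) auto
  ultimately show ?thesis using S(2) by linarith
qed

lemma max_cut_attained:
  assumes "finite V" "E \<subseteq> all_edges V"
  obtains S where "S \<subseteq> V" "card E = max_cut V E + card (uncut_edges V E S)"
proof -
  have "finite E" using assms finite_all_edges finite_subset by blast
  then have *: "card (cut_edges V E S) + card (uncut_edges V E S) = card E" for S
    by (rule card_uncut_edges)
  have "max_cut V E \<in> (\<lambda>S. card (cut_edges V E S)) ` Pow V"
    unfolding max_cut_def using assms(1) by (intro Max_in) auto
  then obtain S where "S \<subseteq> V" "max_cut V E = card (cut_edges V E S)" by blast
  with *[of S] show ?thesis by (intro that[of S]) simp_all
qed

section \<open>Disjoint odd cycles\<close>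

text \<open>The vertex \<open>x\<close> ends both lists and occurs nowhere earlier, so neither
  extended list is a prefix of the other. For two cycles, \<open>x\<close> is the common start to
  which both return; the divergence may occur at the return itself.\<close>

lemma append_last_diverge:
  assumes "distinct (xs @ [x])" "distinct (ys @ [x])" "xs \<noteq> ys"
  shows "\<exists>c u r w s. xs @ [x] = c @ u # r \<and> ys @ [x] = c @ w # s \<and> u \<noteq> w"
  using assms
proof (induction xs arbitrary: ys)
  case Nil
  then obtain b bs where "ys = b # bs" by (cases ys) auto
  with Nil show ?case by (intro exI[of _ "[]"]) auto
next
  case (Cons a xs)
  show ?case
  proof (cases ys)
    case Nil
    with Cons.prems show ?thesis by (intro exI[of _ "[]"]) auto
  next
    case (Cons b bs)
    show ?thesis
    proof (cases "a = b")
      case True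
      then obtain c u r w s where "xs @ [x] = c @ u # r" "bs @ [x] = c @ w # s" "u \<noteq> w"
        using Cons.IH[of bs] Cons.prems Cons by auto
      then show ?thesis using True Cons
        by (intro exI[of _ "a # c"] exI[of _ u] exI[of _ r] exI[of _ w] exI[of _ s]) simp
    next
      case False
      then show ?thesis using Cons by (intro exI[of _ "[]"]) auto
    qed
  qed
qed

text \<open>Ensures that a path with a nonempty interior lying off a cycle shares no edge with that
  cycle.\<close>

lemma path_edges_meet:
  assumes "xs \<noteq> []" "e \<in> path_edges (a # xs @ [b])"
  shows "e \<inter> set xs \<noteq> {}"
proof -
  have *: "d \<inter> set ys \<noteq> {}" if "d \<in> path_edges (ys @ [b])" for d ys
    using that
  proof (induction ys)
    case (Cons y ys)
    then show ?case by (cases ys) auto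
  qed auto
  from assms(1) obtain c ys where xs: "xs = c # ys" by (cases xs) auto
  with assms(2) *[of e xs] show ?thesis by auto
qed

text \<open>Following the second cycle from the point where it leaves the first one until it first
  returns yields the ear.\<close>

lemma ear_of_two_cycles:
  assumes xs: "xs \<in> cycles V E k" and ys: "ys \<in> cycles V E l" and "3 \<le> k" "3 \<le> l"
    and start: "xs ! 0 = ys ! 0" "xs ! 1 = ys ! 1" and "xs \<noteq> ys"
  shows "\<exists>i j zs. (rotate i xs, j, zs) \<in> ears V E k (length zs) \<and> length zs < l"
proof -
  have xs': "length xs = k" "distinct xs" "set xs \<subseteq> V" "cycle_edges xs \<subseteq> E"
    using xs by (auto simp: cycles_def)
  have ys': "length ys = l" "distinct ys" "set ys \<subseteq> V" "cycle_edges ys \<subseteq> E"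
    using ys by (auto simp: cycles_def)
  obtain x0 x1 x2 xs2 where x: "xs = x0 # x1 # x2 # xs2"
    using xs'(1) \<open>3 \<le> k\<close> by (auto simp: numeral_3_eq_3 Suc_le_length_iff)
  define xt where "xt = x2 # xs2"
  obtain y0 y1 y2 ys2 where y0: "ys = y0 # y1 # y2 # ys2"
    using ys'(1) \<open>3 \<le> l\<close> by (auto simp: numeral_3_eq_3 Suc_le_length_iff)
  define yt where "yt = y2 # ys2"
  have x: "xs = x0 # x1 # xt" using x xt_def by simp
  have y: "ys = x0 # x1 # yt" "yt \<noteq> []" using y0 x start yt_def by auto
  have "distinct (xt @ [x0])" "distinct (yt @ [x0])" "xt \<noteq> yt"
    using xs' ys' \<open>xs \<noteq> ys\<close> x y by auto
  then obtain c u r w s where c: "xt @ [x0] = c @ u # r" "yt @ [x0] = c @ w # s" "u \<noteq> w"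
    using append_last_diverge by metis
  \<comment> \<open>The last vertex \<open>a\<close> of the common initial stretch and its
    predecessor \<open>z\<close>, which exists because \<open>x0\<close> and \<open>x1\<close> are
    both shared.\<close>
  define a where "a = last (x1 # c)"
  define z where "z = last (x0 # butlast (x1 # c))"
  define d where "d = butlast (x0 # butlast (x1 # c))"
  have dz: "d @ [z] = x0 # butlast (x1 # c)"
    unfolding d_def z_def by (rule append_butlast_last_id) simp
  have "butlast (x1 # c) @ [a] = x1 # c"
    unfolding a_def by (rule append_butlast_last_id) simp
  then have dza: "x0 # x1 # c = d @ [z, a]"
    using dz by (metis append.assoc append_Cons append_Nil)
  \<comment> \<open>Both cycles are relisted from \<open>x1\<close> round to \<open>x0\<close>, so
    that the return to \<open>x0\<close> comes after the divergence.\<close>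
  have distX: "distinct (x1 # c @ u # r)" and setX: "set (x1 # c @ u # r) = set xs"
    using xs'(2) unfolding c(1)[symmetric] x by auto
  have distY: "distinct (x1 # c @ w # s)" and setY: "set (x1 # c @ w # s) = set ys"
    using ys'(2) unfolding c(2)[symmetric] y by auto
  have lasts: "last (u # r) = x0" "last (w # s) = x0"
    using c(1,2) by (metis last_appendR last_snoc list.distinct(1))+
  have x0u: "x0 \<in> set (u # r)" using lasts(1) last_in_set[of "u # r"] by simp
  have x0w: "x0 \<in> set (w # s)" using lasts(2) last_in_set[of "w # s"] by simp
  have x0c: "x0 \<notin> set (x1 # c)" using distX x0u by auto
  have ac: "a \<in> set (x1 # c)" unfolding a_def by (rule last_in_set) simp
  have cycX: "cycle_edges xs = path_edges (d @ [z, a] @ u # r)"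
    using c(1) dza x by (metis append_Cons append.assoc cycle_edges_Cons)
  have cycY: "cycle_edges ys = path_edges (d @ [z, a] @ w # s)"
    using c(2) dza y by (metis append_Cons append.assoc cycle_edges_Cons)
  have "x0 \<in> set xs" using x by simp
  with x0w have "\<exists>v \<in> set (w # s). v \<in> set xs" by blast
  \<comment> \<open>\<open>b\<close> is the first vertex of the second cycle beyond the common
    stretch that lies on the first cycle; the return to \<open>x0\<close> guarantees one.
    \<open>int\<close> is the interior of the ear.\<close>
  then obtain int b t where int: "w # s = int @ b # t" "b \<in> set xs" "\<forall>v\<in>set int. v \<notin> set xs"
    by (rule split_list_first_propE) blast
  let ?p = "a # int @ [b]"
  have distp: "distinct ?p" using distY ac unfolding int(1) by auto
  have "path_edges ?p \<subseteq> cycle_edges ys"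
    using path_edges_append[of "d @ [z]" a "int @ b # t"] path_edges_append[of "a # int" b t]
    unfolding cycY int(1) by auto
  then have pE: "path_edges ?p \<subseteq> E" using ys'(4) by blast
  have disj: "path_edges ?p \<inter> cycle_edges xs = {}"
  \<comment> \<open>With a nonempty interior, every edge of the ear has a vertex off
    \<open>xs\<close>. Otherwise the ear is the single edge \<open>{a, w}\<close>, and the only
    cycle edges at \<open>a\<close> are \<open>{z, a}\<close> and \<open>{a, u}\<close>.\<close>
  proof (cases "int = []")
    case False
    then show ?thesis
      using path_edges_meet[OF False, of _ a b] path_edges_subset[of _ "xs @ [hd xs]"] int(3)
        \<open>x0 \<in> set xs\<close> x unfolding cycle_edges_def by fastforce
  next
    case True
    then have b: "b = w" using int(1) by simp
    have cyc: "cycle_edges xs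
        = path_edges (d @ [z]) \<union> {{z, a}, {a, u}} \<union> path_edges (u # r)"
      using path_edges_append[of d z "a # u # r"] unfolding cycX by auto
    have "distinct (d @ [z, a])" using distX x0c unfolding dza[symmetric] by auto
    then have "a \<notin> set (d @ [z])" by auto
    then have 1: "{a, w} \<notin> path_edges (d @ [z])" using path_edges_subset by blast
    have "a \<notin> set (u # r)" using distX ac by auto
    then have 2: "{a, w} \<notin> path_edges (u # r)" using path_edges_subset by blast
    \<comment> \<open>Equality would force \<open>z = x0\<close> and an empty \<open>c\<close>, so
      the second cycle would return to \<open>x0\<close> right after \<open>x1\<close>, against its
      length.\<close>
    have "w \<noteq> z"
    proof
      assume "w = z"
      have "w \<notin> set (x1 # c)" using distY by auto
      moreover have "z \<in> set (x0 # x1 # c)" unfolding dza by simp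
      ultimately have "z = x0" using \<open>w = z\<close> by auto
      have "d = []"
      proof (cases d)
        case (Cons v vs)
        then have "z \<in> set (x1 # c)" using dza by (metis append_Cons in_set_conv_decomp list.inject)
        with \<open>z = x0\<close> x0c show ?thesis by simp
      qed
      then have "c = []" using dza by simp
      then have "yt @ [x0] = x0 # s" using c(2) \<open>w = z\<close> \<open>z = x0\<close> by simp
      then show False using y ys'(2) by (cases yt) auto
    qed
    then have 3: "{a, w} \<noteq> {z, a}" "{a, w} \<noteq> {a, u}" using c(3) by (auto simp: doubleton_eq_iff)
    show ?thesis using 1 2 3 by (simp add: True b cyc)
  qed
  have "a \<in> set xs" using ac setX by auto
  \<comment> \<open>Ears leave at the first vertex of the list, so the cycle is rotated to start at
    \<open>a\<close>.\<close>
  then obtain i where i: "i < k" "xs ! i = a" using xs'(1) by (auto simp: in_set_conv_nth)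
  have hdr: "hd (rotate i xs) = a"
    using i xs'(1) hd_rotate_conv_nth[of xs i] x by simp
  obtain j where j: "j < k" "rotate i xs ! j = b"
    using int(2) xs'(1) in_set_conv_nth[of b "rotate i xs"] by auto
  have "set int \<subseteq> set ys" using setY unfolding int(1) by auto
  then have intV: "set int \<subseteq> V" using ys'(3) by blast
  have "length (yt @ [x0]) = length (c @ int @ b # t)" unfolding c(2) int(1) by simp
  then have "length int < l" using ys'(1) y by simp
  moreover have "(rotate i xs, j, int) \<in> ears V E k (length int)"
    using cycles_rotate[OF xs, of i] j intV distp pE disj
    unfolding ears_def hdr by (auto simp: hdr cycle_edges_rotate)
  ultimately show ?thesis by blast
qed

text \<open>Otherwise membership in \<open>S\<close> alternates along the cycle, which an odd number
  of steps back to the start contradicts. The rotation brings the uncut edge to the front.\<close>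

lemma odd_cycle_uncut:
  assumes "odd (length xs)" "length xs \<ge> 3"
  shows "\<exists>i. (rotate i xs ! 0 \<in> S) = (rotate i xs ! 1 \<in> S)"
proof (rule ccontr)
  assume no: "\<nexists>i. (rotate i xs ! 0 \<in> S) = (rotate i xs ! 1 \<in> S)"
  have alt: "(xs ! (i mod length xs) \<in> S) \<noteq> (xs ! (Suc i mod length xs) \<in> S)" for i
  proof -
    have "0 < length xs" "1 < length xs" using assms(2) by auto
    then have "rotate i xs ! 0 = xs ! (i mod length xs)" "rotate i xs ! 1 = xs ! (Suc i mod length xs)"
      by (auto simp: nth_rotate)
    with no show ?thesis by metis
  qed
  have "(xs ! (i mod length xs) \<in> S) = ((xs ! 0 \<in> S) = even i)" for i
  proof (induction i)
    case (Suc i)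
    then show ?case using alt[of i] by auto
  qed auto
  from this[of "length xs"] assms(1) show False by simp
qed

text \<open>An edge can be traversed in two directions; this is the source of the factor 2 when
  cycles are counted by their first edge.\<close>

lemma card_ordered_pairs_le:
  assumes "finite U" "U \<subseteq> all_edges V"
  shows "finite {(a, b). {a, b} \<in> U}" "card {(a, b). {a, b} \<in> U} \<le> 2 * card U"
proof -
  have *: "finite {(a, b). {a, b} = e} \<and> card {(a, b). {a, b} = e} \<le> 2" if "e \<in> U" for e
  proof -
    from assms(2) that obtain u v where "e = {u, v}" by (rule edge_cases)
    then have "{(a, b). {a, b} = e} \<subseteq> {(u, v), (v, u)}" by (auto simp: doubleton_eq_iff)
    then show ?thesis
      using finite_subset[of _ "{(u, v), (v, u)}"] card_mono[of "{(u, v), (v, u)}"]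
        card_length[of "[(u, v), (v, u)]"]
      by (metis (no_types, lifting) finite.emptyI finite.insertI le_trans length_Cons list.size(3)
        list.simps(15) numeral_2_eq_2 set_empty2)
  qed
  have eq: "{(a, b). {a, b} \<in> U} = (\<Union>e\<in>U. {(a, b). {a, b} = e})" by auto
  show "finite {(a, b). {a, b} \<in> U}" unfolding eq using assms(1) * by blast
  have "card {(a, b). {a, b} \<in> U} \<le> (\<Sum>e\<in>U. card {(a, b). {a, b} = e})"
    unfolding eq using assms(1) by (rule card_UN_le)
  also have "\<dots> \<le> (\<Sum>e\<in>U. 2)" using * by (intro sum_mono) auto
  finally show "card {(a, b). {a, b} \<in> U} \<le> 2 * card U" by simp
qed

text \<open>Cycles none of whose rotations starts an ear are determined by any two consecutive
  vertices, hence by an ordered uncut edge; the factors 1/k account for rotations.\<close>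

lemma sum_cycles_le_uncut_ears:
  assumes "finite V" "E \<subseteq> all_edges V" "finite K"
    and K: "\<And>k. k \<in> K \<Longrightarrow> odd k \<and> 3 \<le> k \<and> k \<le> L"
  shows "(\<Sum>k\<in>K. card (cycles V E k) / k)
    \<le> 2 * card (uncut_edges V E S) + (\<Sum>k\<in>K. \<Sum>q<L. real (card (ears V E k q)))"
proof -
  \<comment> \<open>\<open>T k\<close> holds the cycles that start an ear with fewer than
    \<open>L\<close> interior vertices, \<open>Bad k\<close> is its closure under rotation and
    \<open>Good k\<close> the rest. \<open>GF k\<close> keeps the good cycles whose first edge is
    uncut.\<close>
  define T where "T k = (\<Union>q<L. fst ` ears V E k q)" for k
  define Bad where "Bad k = {xs \<in> cycles V E k. \<exists>i. rotate i xs \<in> T k}" for k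
  define Good where "Good k = {xs \<in> cycles V E k. \<forall>i. rotate i xs \<notin> T k}" for k
  define GF where "GF k = {xs \<in> Good k. {xs ! 0, xs ! 1} \<in> uncut_edges V E S}" for k
  have "finite E" using assms finite_all_edges finite_subset by blast
  then have finU: "finite (uncut_edges V E S)" by (simp add: uncut_edges_def)
  have finT: "finite (T k)" for k using assms(1) by (auto simp: T_def finite_ears)
  have finGF: "finite (GF k)" for k
    using finite_cycles[OF assms(1), of E k] by (simp add: GF_def Good_def)
  have split: "card (cycles V E k) = card (Good k) + card (Bad k)" for k
  proof -
    have "cycles V E k = Good k \<union> Bad k" "Good k \<inter> Bad k = {}" by (auto simp: Good_def Bad_def)
    moreover have "finite (Good k)" "finite (Bad k)"
      using finite_cycles[OF assms(1), of E k] by (auto simp: Good_def Bad_def)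
    ultimately show ?thesis by (simp add: card_Un_disjoint)
  qed
  have bad: "card (Bad k) \<le> k * (\<Sum>q<L. card (ears V E k q))" if "k \<in> K" for k
  proof -
    have "card (Bad k) \<le> k * card (T k)"
      using K[OF that] finT by (intro card_le_rotations) (auto simp: Bad_def cycles_def)
    also have "card (T k) \<le> (\<Sum>q<L. card (fst ` ears V E k q))"
      unfolding T_def by (rule card_UN_le) simp
    also have "\<dots> \<le> (\<Sum>q<L. card (ears V E k q))"
      using assms(1) by (intro sum_mono card_image_le finite_ears)
    finally show ?thesis by simp
  qed
  \<comment> \<open>Some rotation of an odd cycle puts an uncut edge first, and
    \<open>Good k\<close> is closed under rotation.\<close>
  have good: "card (Good k) \<le> k * card (GF k)" if "k \<in> K" for k
  proof (rule card_le_rotations[OF finGF])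
    show "k > 0" using K[OF that] by simp
    show "length xs = k" if "xs \<in> Good k" for xs using that by (simp add: Good_def cycles_def)
    show "\<exists>i. rotate i xs \<in> GF k" if xs: "xs \<in> Good k" for xs
    proof -
      have xs': "xs \<in> cycles V E k" "length xs = k"
        using xs by (auto simp: Good_def cycles_def)
      then obtain i where i: "(rotate i xs ! 0 \<in> S) = (rotate i xs ! 1 \<in> S)"
        using odd_cycle_uncut[of xs S] K[OF \<open>k \<in> K\<close>] by auto
      have "rotate i xs \<in> Good k"
        using xs cycles_rotate[of xs V E k i] by (auto simp: Good_def rotate_rotate)
      moreover have "{rotate i xs ! 0, rotate i xs ! 1} \<in> E"
      proof -
        obtain a b zs where r: "rotate i xs = a # b # zs"
          using xs'(2) K[OF \<open>k \<in> K\<close>] length_rotate[of i xs]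
          by (cases "rotate i xs" rule: path_edges.cases) auto
        have "cycle_edges (rotate i xs) \<subseteq> E"
          using xs'(1) by (simp add: cycles_def cycle_edges_rotate)
        then show ?thesis by (simp add: r cycle_edges_def)
      qed
      ultimately show ?thesis
        using i uncut_edges_iff[OF assms(2)] by (auto simp: GF_def)
    qed
  qed
  have "(\<Sum>k\<in>K. card (GF k)) = card (\<Union>k\<in>K. GF k)"
    using assms(3) finGF
    by (intro card_UN_disjoint[symmetric]) (auto simp: GF_def Good_def cycles_def)
  \<comment> \<open>The first two vertices determine the cycle, even across different lengths in
    \<open>K\<close>: two such cycles would give a rotation of one of them an ear with fewer than
    \<open>L\<close> interior vertices.\<close>
  also have "\<dots> = card ((\<lambda>xs. (xs ! 0, xs ! 1)) ` (\<Union>k\<in>K. GF k))"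
  proof (rule card_image[symmetric], rule inj_onI)
    fix xs ys
    assume "xs \<in> (\<Union>k\<in>K. GF k)" "ys \<in> (\<Union>k\<in>K. GF k)"
      and eq: "(xs ! 0, xs ! 1) = (ys ! 0, ys ! 1)"
    then obtain k l where k: "k \<in> K" "xs \<in> GF k" and l: "l \<in> K" "ys \<in> GF l" by blast
    show "xs = ys"
    proof (rule ccontr)
      assume "xs \<noteq> ys"
      then obtain i j zs where "(rotate i xs, j, zs) \<in> ears V E k (length zs)" "length zs < l"
        using ear_of_two_cycles[of xs V E k ys l] k l K eq by (auto simp: GF_def Good_def)
      moreover have "l \<le> L" using K l by simp
      ultimately have "rotate i xs \<in> T k"
        unfolding T_def by (intro UN_I[of "length zs"]) (auto intro!: image_eqI)
      with k show False by (auto simp: GF_def Good_def)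
    qed
  qed
  also have "\<dots> \<le> card {(a, b). {a, b} \<in> uncut_edges V E S}"
    using finU assms(2)
    by (intro card_mono card_ordered_pairs_le[of _ V]) (auto simp: GF_def uncut_edges_def)
  also have "\<dots> \<le> 2 * card (uncut_edges V E S)"
    using finU assms(2) by (intro card_ordered_pairs_le[of _ V]) (auto simp: uncut_edges_def)
  finally have GF: "(\<Sum>k\<in>K. card (GF k)) \<le> 2 * card (uncut_edges V E S)" .
  have "(\<Sum>k\<in>K. card (cycles V E k) / k)
      \<le> (\<Sum>k\<in>K. real (card (GF k)) + (\<Sum>q<L. real (card (ears V E k q))))"
  proof (rule sum_mono)
    fix k assume "k \<in> K"
    have "card (cycles V E k) \<le> (card (GF k) + (\<Sum>q<L. card (ears V E k q))) * k"
      using split[of k] bad[OF \<open>k \<in> K\<close>] good[OF \<open>k \<in> K\<close>] by (simp add: algebra_simps)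
    then have "real (card (cycles V E k)) \<le> real ((card (GF k) + (\<Sum>q<L. card (ears V E k q))) * k)"
      by (rule of_nat_mono)
    moreover have "k > 0" using K[OF \<open>k \<in> K\<close>] by simp
    ultimately show "card (cycles V E k) / k
        \<le> real (card (GF k)) + (\<Sum>q<L. real (card (ears V E k q)))"
      by (simp add: divide_le_eq)
  qed
  also have "\<dots> = real (\<Sum>k\<in>K. card (GF k)) + (\<Sum>k\<in>K. \<Sum>q<L. real (card (ears V E k q)))"
    by (simp add: sum.distrib)
  also have "\<dots> \<le> real (2 * card (uncut_edges V E S))
      + (\<Sum>k\<in>K. \<Sum>q<L. real (card (ears V E k q)))"
    using GF by (intro add_right_mono of_nat_mono)
  finally show ?thesis by simp
qed

section \<open>Counting copies in the random graph\<close>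

text \<open>Removing \<open>F\<close> is a bijection onto the subsets of \<open>A - F\<close> of
  size \<open>m - card F\<close>, with adding \<open>F\<close> as its inverse.\<close>

lemma card_supersets:
  assumes "finite A" "F \<subseteq> A" "card F \<le> m"
  shows "card {E. E \<subseteq> A \<and> card E = m \<and> F \<subseteq> E} = (card A - card F) choose (m - card F)"
proof -
  have finF: "finite F" using assms finite_subset by blast
  have "bij_betw (\<lambda>E. E - F) {E. E \<subseteq> A \<and> card E = m \<and> F \<subseteq> E}
      {D. D \<subseteq> A - F \<and> card D = m - card F}"
  proof (rule bij_betw_byWitness[where f' = "\<lambda>D. D \<union> F"])
    show "(\<lambda>E. E - F) ` {E. E \<subseteq> A \<and> card E = m \<and> F \<subseteq> E}
        \<subseteq> {D. D \<subseteq> A - F \<and> card D = m - card F}"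
      using finF by (auto simp: card_Diff_subset)
    show "(\<lambda>D. D \<union> F) ` {D. D \<subseteq> A - F \<and> card D = m - card F}
        \<subseteq> {E. E \<subseteq> A \<and> card E = m \<and> F \<subseteq> E}"
    proof clarify
      fix D assume D: "D \<subseteq> A - F" "card D = m - card F"
      then have "finite D" using assms(1) finite_subset by blast
      moreover have "D \<inter> F = {}" using D by auto
      ultimately have "card (D \<union> F) = m" using D(2) finF assms(3) by (simp add: card_Un_disjoint)
      with D assms(2) show "D \<union> F \<subseteq> A \<and> card (D \<union> F) = m \<and> F \<subseteq> D \<union> F" by auto
    qed
  qed auto
  then have "card {E. E \<subseteq> A \<and> card E = m \<and> F \<subseteq> E} = card {D. D \<subseteq> A - F \<and> card D = m - card F}"
    by (rule bij_betw_same_card)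
  also have "\<dots> = card (A - F) choose (m - card F)"
    using assms(1) by (intro n_subsets) auto
  finally show ?thesis using assms finF by (simp add: card_Diff_subset)
qed

text \<open>The absorption identity. Read as probability: when \<open>j\<close> prescribed edges are
  present, the next one is present with probability \<open>(m - j) / (N - j)\<close>.\<close>

lemma binomial_diff_Suc:
  assumes "j < m" "m \<le> N"
  shows "real ((N - Suc j) choose (m - Suc j))
    = (real m - j) / (real N - j) * ((N - j) choose (m - j))"
proof -
  have "(m - j) * ((N - j) choose (m - j)) = (N - j) * ((N - j - 1) choose (m - j - 1))"
    using assms by (intro times_binomial_minus1_eq) auto
  then have "real (m - j) * ((N - j) choose (m - j))
      = real (N - j) * ((N - Suc j) choose (m - Suc j))"
    by (metis diff_Suc_eq_diff_pred diff_commute of_nat_mult One_nat_def)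
  with assms show ?thesis by (simp add: of_nat_diff field_simps)
qed

text \<open>Every factor \<open>(m - i) / (N - i)\<close> is at most \<open>m / N\<close> because
  \<open>m \<le> N\<close>.\<close>

lemma binomial_diff_le:
  assumes "j \<le> m" "m \<le> N"
  shows "real ((N - j) choose (m - j)) \<le> (m / N) ^ j * (N choose m)"
  using assms(1)
proof (induction j)
  case (Suc j)
  have "real m * j \<le> real N * j" using assms(2) by (intro mult_right_mono) auto
  then have "(real m - j) / (real N - j) \<le> m / N"
    using Suc.prems assms(2) by (simp add: field_simps)
  then have "(real m - j) / (real N - j) * ((N - j) choose (m - j))
      \<le> m / N * ((m / N) ^ j * (N choose m))"
    using Suc by (intro mult_mono) auto
  then show ?case using Suc.prems assms(2) by (subst binomial_diff_Suc) (auto simp: mult_ac)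
qed auto

text \<open>Every factor \<open>(m - i) / (N - i)\<close> with \<open>i < t\<close> is at least
  \<open>(m - t) / N\<close>.\<close>

lemma binomial_diff_ge:
  assumes "j \<le> t" "t \<le> m" "m \<le> N"
  shows "((real m - t) / N) ^ j * (N choose m) \<le> real ((N - j) choose (m - j))"
  using assms(1)
proof (induction j)
  case (Suc j)
  have "(real m - t) / N \<le> (real m - j) / (real N - j)"
    using Suc.prems assms by (intro frac_le) auto
  then have "(real m - t) / N * (((real m - t) / N) ^ j * (N choose m))
      \<le> (real m - j) / (real N - j) * ((N - j) choose (m - j))"
    using Suc assms by (intro mult_mono) auto
  then show ?case using Suc.prems assms by (subst binomial_diff_Suc) (auto simp: mult_ac)
qed auto

lemma card_graphs_nm: "card (graphs_nm n m) = (n choose 2) choose m"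
  unfolding graphs_nm_def using n_subsets[of "all_edges {..<n}" m]
  by (simp add: finite_all_edges card_all_edges)

lemma card_graphs_nm_containing:
  assumes "F \<subseteq> all_edges {..<n}" "card F \<le> m"
  shows "card {E \<in> graphs_nm n m. F \<subseteq> E} = ((n choose 2) - card F) choose (m - card F)"
  using card_supersets[of "all_edges {..<n}" F m] assms
  by (simp add: finite_all_edges card_all_edges graphs_nm_def conj_assoc)

lemma card_graphs_nm_containing_le:
  assumes "F \<subseteq> all_edges {..<n}" "m \<le> n choose 2"
  shows "real (card {E \<in> graphs_nm n m. F \<subseteq> E})
    \<le> (m / (n choose 2)) ^ card F * card (graphs_nm n m)"
proof (cases "card F \<le> m")
  case True
  with assms show ?thesis
    using binomial_diff_le[of "card F" m "n choose 2"]
    by (simp add: card_graphs_nm card_graphs_nm_containing)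
next
  case False
  have "{E \<in> graphs_nm n m. F \<subseteq> E} = {}"
  proof (rule ccontr)
    assume "{E \<in> graphs_nm n m. F \<subseteq> E} \<noteq> {}"
    then obtain E where E: "E \<subseteq> all_edges {..<n}" "card E = m" "F \<subseteq> E"
      by (auto simp: graphs_nm_def)
    then have "card F \<le> m"
      using finite_all_edges[of "{..<n}"] by (metis card_mono finite_lessThan finite_subset)
    with False show False by simp
  qed
  then have "card {E \<in> graphs_nm n m. F \<subseteq> E} = 0" by (simp only: card.empty)
  then show ?thesis by simp
qed

text \<open>Double counting in the role of linearity of expectation, with \<open>F x\<close> the
  edge set of a possible copy \<open>x\<close>. Moments are kept as sums over all graphs, so
  \<open>card (graphs_nm n m)\<close> appears as a factor in the bounds below.\<close>

lemma sum_card_containing: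
  assumes "finite X" "finite Y"
  shows "(\<Sum>E\<in>Y. real (card {x \<in> X. F x \<subseteq> E})) = (\<Sum>x\<in>X. real (card {E \<in> Y. F x \<subseteq> E}))"
proof -
  have "(\<Sum>E\<in>Y. real (card {x \<in> X. F x \<subseteq> E})) = (\<Sum>E\<in>Y. \<Sum>x\<in>X. of_bool (F x \<subseteq> E))"
    using assms by (simp add: Int_def)
  also have "\<dots> = (\<Sum>x\<in>X. \<Sum>E\<in>Y. of_bool (F x \<subseteq> E))" by (rule sum.swap)
  also have "\<dots> = (\<Sum>x\<in>X. real (card {E \<in> Y. F x \<subseteq> E}))"
    using assms by (simp add: Int_def)
  finally show ?thesis .
qed

lemma sum_copies_le:
  assumes "finite X" "m \<le> n choose 2"
    and "\<And>x. x \<in> X \<Longrightarrow> F x \<subseteq> all_edges {..<n} \<and> card (F x) = j"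
  shows "(\<Sum>E\<in>graphs_nm n m. real (card {x \<in> X. F x \<subseteq> E}))
    \<le> card X * (m / (n choose 2)) ^ j * card (graphs_nm n m)"
proof -
  have "(\<Sum>x\<in>X. real (card {E \<in> graphs_nm n m. F x \<subseteq> E}))
      \<le> (\<Sum>x\<in>X. (m / (n choose 2)) ^ j * card (graphs_nm n m))"
  proof (rule sum_mono)
    fix x assume "x \<in> X"
    then show "real (card {E \<in> graphs_nm n m. F x \<subseteq> E})
        \<le> (m / (n choose 2)) ^ j * card (graphs_nm n m)"
      using card_graphs_nm_containing_le[of "F x" n m] assms(2,3) by auto
  qed
  then show ?thesis using assms(1) by (simp add: sum_card_containing finite_graphs_nm)
qed

lemma sum_copies_ge:
  assumes "finite X" "m \<le> n choose 2" "j \<le> m"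
    and "\<And>x. x \<in> X \<Longrightarrow> F x \<subseteq> all_edges {..<n} \<and> card (F x) = j"
  shows "card X * ((real m - j) / (n choose 2)) ^ j * card (graphs_nm n m)
    \<le> (\<Sum>E\<in>graphs_nm n m. real (card {x \<in> X. F x \<subseteq> E}))"
proof -
  have "(\<Sum>x\<in>X. ((real m - j) / (n choose 2)) ^ j * card (graphs_nm n m))
      \<le> (\<Sum>x\<in>X. real (card {E \<in> graphs_nm n m. F x \<subseteq> E}))"
  proof (rule sum_mono)
    fix x assume "x \<in> X"
    then show "((real m - j) / (n choose 2)) ^ j * card (graphs_nm n m)
        \<le> real (card {E \<in> graphs_nm n m. F x \<subseteq> E})"
      using binomial_diff_ge[of j j m "n choose 2"] assms(2-4)
      by (auto simp: card_graphs_nm card_graphs_nm_containing)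
  qed
  then show ?thesis using assms(1) by (simp add: sum_card_containing finite_graphs_nm)
qed

section \<open>Expected numbers of cycles and ears\<close>

lemma cycles_eq_copies:
  "cycles V E k = {xs \<in> {xs. length xs = k \<and> distinct xs \<and> set xs \<subseteq> V}. cycle_edges xs \<subseteq> E}"
  by (auto simp: cycles_def)

lemma cycle_copies:
  assumes "k \<ge> 3" "xs \<in> {xs. length xs = k \<and> distinct xs \<and> set xs \<subseteq> V}"
  shows "cycle_edges xs \<subseteq> all_edges V \<and> card (cycle_edges xs) = k"
  using assms by (auto simp: card_cycle_edges dest: subsetD[OF cycle_edges_subset_all_edges, rotated 3])

lemma card_distinct_lists_le: "card {xs. length xs = k \<and> distinct xs \<and> set xs \<subseteq> {..<n}} \<le> n ^ k"
proof -
  have "card {xs. length xs = k \<and> distinct xs \<and> set xs \<subseteq> {..<n}}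
      \<le> card {xs. set xs \<subseteq> {..<n} \<and> length xs = k}"
    by (intro card_mono finite_lists_length_eq) auto
  then show ?thesis by (simp add: card_lists_length_eq)
qed

text \<open>The count is a falling factorial with \<open>k\<close> factors, each at least
  \<open>n - k\<close>.\<close>

lemma card_distinct_lists_ge:
  assumes "k \<le> n"
  shows "(real n - k) ^ k \<le> card {xs. length xs = k \<and> distinct xs \<and> set xs \<subseteq> {..<n}}"
proof -
  have "(real n - k) ^ k = (\<Prod>i\<in>{n - k + 1..n}. real n - k)" using assms by simp
  also have "\<dots> \<le> (\<Prod>i\<in>{n - k + 1..n}. real i)"
    using assms by (intro prod_mono) auto
  also have "\<dots> = card {xs. length xs = k \<and> distinct xs \<and> set xs \<subseteq> {..<n}}"
    using assms by (simp add: card_lists_distinct_length_eq)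
  finally show ?thesis .
qed

lemma sum_card_cycles_le:
  assumes "m \<le> n choose 2" "k \<ge> 3"
  shows "(\<Sum>E\<in>graphs_nm n m. real (card (cycles {..<n} E k)))
    \<le> (n * (m / (n choose 2))) ^ k * card (graphs_nm n m)"
proof -
  let ?X = "{xs. length xs = k \<and> distinct xs \<and> set xs \<subseteq> {..<n}}"
  have "(\<Sum>E\<in>graphs_nm n m. real (card (cycles {..<n} E k)))
      \<le> card ?X * (m / (n choose 2)) ^ k * card (graphs_nm n m)"
    unfolding cycles_eq_copies using assms cycle_copies
    by (intro sum_copies_le finite_lists_distinct) auto
  also have "\<dots> \<le> real (n ^ k) * (m / (n choose 2)) ^ k * card (graphs_nm n m)"
    by (intro mult_right_mono of_nat_mono card_distinct_lists_le) auto
  finally show ?thesis by (simp add: power_mult_distrib power_divide)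
qed

lemma sum_card_cycles_ge:
  assumes "m \<le> n choose 2" "k \<ge> 3" "k \<le> m" "k \<le> n"
  shows "((real n - k) * ((real m - k) / (n choose 2))) ^ k * card (graphs_nm n m)
    \<le> (\<Sum>E\<in>graphs_nm n m. real (card (cycles {..<n} E k)))"
proof -
  let ?X = "{xs. length xs = k \<and> distinct xs \<and> set xs \<subseteq> {..<n}}"
  have "((real n - k) * ((real m - k) / (n choose 2))) ^ k * card (graphs_nm n m)
      = (real n - k) ^ k * ((real m - k) / (n choose 2)) ^ k * card (graphs_nm n m)"
    by (simp only: power_mult_distrib)
  also have "\<dots> \<le> card ?X * ((real m - k) / (n choose 2)) ^ k * card (graphs_nm n m)"
    using assms by (intro mult_right_mono card_distinct_lists_ge) auto
  also have "\<dots> \<le> (\<Sum>E\<in>graphs_nm n m. real (card (cycles {..<n} E k)))"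
    unfolding cycles_eq_copies using assms cycle_copies
    by (intro sum_copies_ge finite_lists_distinct) auto
  finally show ?thesis .
qed

text \<open>There are at most \<open>n ^ k\<close> cycles, \<open>k\<close> ends and
  \<open>n ^ q\<close> interiors. The \<open>k + q + 1\<close> edges outnumber the
  \<open>k + q\<close> vertices by one, which later saves a factor \<open>n\<close>.\<close>

lemma sum_card_ears_le:
  assumes "m \<le> n choose 2" "k \<ge> 3"
  shows "(\<Sum>E\<in>graphs_nm n m. real (card (ears {..<n} E k q)))
    \<le> k * n ^ (k + q) * (m / (n choose 2)) ^ (k + q + 1) * card (graphs_nm n m)"
proof -
  \<comment> \<open>\<open>X\<close> collects the candidate ears in the complete graph and
    \<open>F\<close> gives their edge sets. Disjointness of path and cycle is part of
    \<open>X\<close>, so that every candidate has exactly \<open>k + q + 1\<close> edges.\<close>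
  define F where "F = (\<lambda>(xs, j, ys). cycle_edges xs \<union> path_edges (hd xs # ys @ [xs ! j :: nat]))"
  define X where "X = {(xs, j, ys). xs \<in> {xs. length xs = k \<and> distinct xs \<and> set xs \<subseteq> {..<n}} \<and>
     j < k \<and> length ys = q \<and> set ys \<subseteq> {..<n} \<and> distinct (hd xs # ys @ [xs ! j]) \<and>
        path_edges (hd xs # ys @ [xs ! j]) \<inter> cycle_edges xs = {}}"
  define Y where "Y = {xs. length xs = k \<and> distinct xs \<and> set xs \<subseteq> {..<n}} \<times> {..<k} \<times>
     {ys. set ys \<subseteq> {..<n} \<and> length ys = q}"
  have XY: "X \<subseteq> Y" by (auto simp: X_def Y_def)
  have finY: "finite Y" by (auto simp: Y_def intro!: finite_lists_distinct finite_lists_length_eq)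
  have finX: "finite X" using XY finY by (rule finite_subset)
  have copies: "F x \<subseteq> all_edges {..<n} \<and> card (F x) = k + q + 1" if x: "x \<in> X" for x
  proof -
    obtain xs j ys where x': "x = (xs, j, ys)" by (cases x)
    let ?p = "hd xs # ys @ [xs ! j]"
    have xs: "length xs = k" "distinct xs" "set xs \<subseteq> {..<n}" "j < k" "length ys = q"
      "set ys \<subseteq> {..<n}" "distinct ?p" "path_edges ?p \<inter> cycle_edges xs = {}"
      using x by (auto simp: X_def x')
    have "hd xs \<in> set xs" "xs ! j \<in> set xs" using xs assms(2) by (auto intro!: hd_in_set)
    then have p: "set ?p \<subseteq> {..<n}" using xs(3,6) by (simp add: subset_iff)
    have "path_edges ?p \<subseteq> all_edges {..<n}"
      using xs(7) p by (rule path_edges_subset_all_edges)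
    moreover have "cycle_edges xs \<subseteq> all_edges {..<n} \<and> card (cycle_edges xs) = k"
      using cycle_copies[of k xs "{..<n}"] xs assms by auto
    moreover have "card (path_edges ?p) = q + 1" using card_path_edges[of ?p] xs by simp
    moreover have "card (F x) = card (cycle_edges xs) + card (path_edges ?p)"
      using xs(8) by (auto simp: F_def x' intro!: card_Un_disjoint)
    ultimately show ?thesis by (auto simp: F_def x')
  qed
  have ears: "ears {..<n} E k q = {x \<in> X. F x \<subseteq> E}" for E
    by (auto simp: ears_def X_def F_def cycles_def)
  have "card X \<le> card Y" using XY finY by (rule card_mono[rotated])
  also have "\<dots> \<le> n ^ k * (k * n ^ q)"
    unfolding Y_def using card_distinct_lists_le[of k n]
    by (simp add: card_cartesian_product card_lists_length_eq)
  also have "\<dots> = k * n ^ (k + q)" by (simp add: power_add)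
  finally have cardX: "card X \<le> k * n ^ (k + q)" .
  have "(\<Sum>E\<in>graphs_nm n m. real (card (ears {..<n} E k q)))
      \<le> card X * (m / (n choose 2)) ^ (k + q + 1) * card (graphs_nm n m)"
    unfolding ears using assms copies finX by (intro sum_copies_le) auto
  also have "\<dots> \<le> real (k * n ^ (k + q)) * (m / (n choose 2)) ^ (k + q + 1) * card (graphs_nm n m)"
    using cardX by (intro mult_right_mono of_nat_mono) auto
  finally show ?thesis by simp
qed

section \<open>Expected maximum cut\<close>

lemma real_choose_2: "real (n choose 2) = real n * (real n - 1) / 2"
proof -
  have "real (n choose 2) = real (n * (n - 1)) / 2"
    unfolding choose_two by (subst real_of_nat_div) auto
  then show ?thesis by (cases n) (auto simp: algebra_simps)
qed

lemma edges_minus_f_cut: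
  assumes "m \<le> n choose 2"
  shows "(m - f_cut n m) * card (graphs_nm n m)
    = (\<Sum>E\<in>graphs_nm n m. real m - real (max_cut {..<n} E))"
proof -
  have ne: "graphs_nm n m \<noteq> {}" using assms by (rule graphs_nm_nonempty)
  then have "card (graphs_nm n m) \<noteq> 0" using finite_graphs_nm by simp
  moreover have "f_cut n m = (\<Sum>E\<in>graphs_nm n m. real (max_cut {..<n} E)) / card (graphs_nm n m)"
    unfolding f_cut_def G_nm_def using ne finite_graphs_nm by (rule integral_pmf_of_set)
  ultimately show ?thesis by (simp add: sum_subtractf algebra_simps)
qed

lemma sum_power_over_le_ln:
  assumes "0 < x" "x < (1 :: real)"
  shows "(\<Sum>k=3..n. (1 - x) ^ k / k) \<le> ln (1 / x)"
proof -
  \<comment> \<open>The term for \<open>k = 0\<close> is a division by zero and hence 0, so this is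
    the usual logarithm series starting at \<open>k = 1\<close>.\<close>
  have "(\<lambda>k. - ((1 - x) ^ k) / k) sums ln x"
    using ln_series'[of "x - 1"] assms by simp
  then have s: "(\<lambda>k. (1 - x) ^ k / k) sums (- ln x)"
    using sums_minus by fastforce
  have "(\<Sum>k=3..n. (1 - x) ^ k / k) \<le> (\<Sum>k. (1 - x) ^ k / k)"
    using s assms by (intro sum_le_suminf) (auto simp: sums_iff)
  also have "\<dots> = ln (1 / x)" using s assms by (simp add: sums_iff ln_div)
  finally show ?thesis .
qed

text \<open>The quantity \<open>n * (m / (n choose 2))\<close> is essentially the average degree.
  Its \<open>k\<close>-th power bounds the expected number of listed cycles of length
  \<open>k\<close>; dividing by \<open>k\<close> and summing gives the logarithm series.\<close>

lemma edges_minus_f_cut_le: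
  assumes m: "m \<le> n choose 2" and "0 < x" "x < 1" and np: "n * (m / (n choose 2)) \<le> 1 - x"
  shows "m - f_cut n m \<le> ln (1 / x)"
proof -
  let ?G = "graphs_nm n m"
  have pos: "card ?G > 0" using graphs_nm_nonempty[OF m] finite_graphs_nm by (simp add: card_gt_0_iff)
  have "(m - f_cut n m) * card ?G = (\<Sum>E\<in>?G. real m - real (max_cut {..<n} E))"
    using m by (rule edges_minus_f_cut)
  also have "\<dots> \<le> (\<Sum>E\<in>?G. \<Sum>k=3..n. card (cycles {..<n} E k) / k)"
  proof (rule sum_mono)
    fix E assume "E \<in> ?G"
    then show "real m - real (max_cut {..<n} E) \<le> (\<Sum>k=3..n. card (cycles {..<n} E k) / k)"
      using card_edges_minus_max_cut_le[of "{..<n}" E] by (auto simp: graphs_nm_def)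
  qed
  also have "\<dots> = (\<Sum>k=3..n. (\<Sum>E\<in>?G. real (card (cycles {..<n} E k))) / k)"
    by (subst sum.swap) (simp add: sum_divide_distrib)
  also have "\<dots> \<le> (\<Sum>k=3..n. (1 - x) ^ k / k * card ?G)"
  proof (rule sum_mono)
    fix k assume "k \<in> {3..n}"
    then have "(\<Sum>E\<in>?G. real (card (cycles {..<n} E k)))
        \<le> (n * (m / (n choose 2))) ^ k * card ?G"
      using m by (intro sum_card_cycles_le) auto
    also have "\<dots> \<le> (1 - x) ^ k * card ?G"
      using np by (intro mult_right_mono power_mono) auto
    finally show "(\<Sum>E\<in>?G. real (card (cycles {..<n} E k))) / k \<le> (1 - x) ^ k / k * card ?G"
      by (simp add: divide_right_mono)
  qed
  also have "\<dots> = (\<Sum>k=3..n. (1 - x) ^ k / k) * card ?G"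
    by (simp only: sum_distrib_right)
  also have "\<dots> \<le> ln (1 / x) * card ?G"
    using assms by (intro mult_right_mono sum_power_over_le_ln) auto
  finally show ?thesis using pos by simp
qed

text \<open>By \<open>half\<close>, each length \<open>k\<close> contributes at least
  \<open>1 / (2 * k)\<close>. At most \<open>L ^ 2\<close> pairs of cycle length and ear length cost
  at most \<open>L / n\<close> each, so \<open>L ^ 3 \<le> n\<close> bounds the ears by 1. The 2 on
  the right counts the orientations of an uncut edge.\<close>

lemma edges_minus_f_cut_ge:
  fixes K :: "nat set"
  assumes m: "m \<le> n choose 2" and "n > 0" and np: "n * (m / (n choose 2)) \<le> 1"
    and "finite K" and K: "\<And>k. k \<in> K \<Longrightarrow> odd k \<and> 3 \<le> k \<and> k \<le> L" and L: "L ^ 3 \<le> n" "L \<le> m"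
    and half: "\<And>k. k \<in> K \<Longrightarrow> 1 / 2 \<le> ((real n - k) * ((real m - k) / (n choose 2))) ^ k"
  shows "(\<Sum>k\<in>K. 1 / k) / 2 - 1 \<le> 2 * (m - f_cut n m)"
proof -
  let ?G = "graphs_nm n m"
  let ?p = "m / (n choose 2)"
  have pos: "card ?G > 0" using graphs_nm_nonempty[OF m] finite_graphs_nm by (simp add: card_gt_0_iff)
  have "K \<subseteq> {1..L}" using K by fastforce
  then have cardK: "card K \<le> L" using card_mono[of "{1..L}" K] by simp
  have "L \<le> n"
  proof (cases "L = 0")
    case False
    then have "L ^ 1 \<le> L ^ 3" by (intro power_increasing) auto
    with L show ?thesis by simp
  qed simp
  have pointwise: "(\<Sum>k\<in>K. card (cycles {..<n} E k) / k)
      - (\<Sum>k\<in>K. \<Sum>q<L. real (card (ears {..<n} E k q))) \<le> 2 * (real m - max_cut {..<n} E)"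
    if "E \<in> ?G" for E
  proof -
    have E: "E \<subseteq> all_edges {..<n}" "card E = m" using that by (auto simp: graphs_nm_def)
    obtain S where "card E = max_cut {..<n} E + card (uncut_edges {..<n} E S)"
      by (rule max_cut_attained[OF finite_lessThan E(1)])
    then have S: "real m - max_cut {..<n} E = card (uncut_edges {..<n} E S)" using E by simp
    show ?thesis unfolding S
      using sum_cycles_le_uncut_ears[of "{..<n}" E K L S] E K assms(4) by simp
  qed
  have "(\<Sum>k\<in>K. 1 / k) / 2 * card ?G = (\<Sum>k\<in>K. 1 / 2 * card ?G / k)"
    by (simp add: sum_divide_distrib sum_distrib_right) (simp add: mult_ac)
  also have "\<dots> \<le> (\<Sum>k\<in>K. (\<Sum>E\<in>?G. real (card (cycles {..<n} E k))) / k)"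
  proof (intro sum_mono divide_right_mono)
    fix k assume k: "k \<in> K"
    have "1 / 2 * card ?G \<le> ((real n - k) * ((real m - k) / (n choose 2))) ^ k * card ?G"
      using half[OF k] by (rule mult_right_mono) simp
    also have "\<dots> \<le> (\<Sum>E\<in>?G. real (card (cycles {..<n} E k)))"
      using m K[OF k] L \<open>L \<le> n\<close> by (intro sum_card_cycles_ge) auto
    finally show "1 / 2 * card ?G \<le> (\<Sum>E\<in>?G. real (card (cycles {..<n} E k)))" .
  qed simp
  also have "\<dots> = (\<Sum>E\<in>?G. \<Sum>k\<in>K. card (cycles {..<n} E k) / k)"
    by (subst sum.swap) (simp add: sum_divide_distrib)
  finally have cyc: "(\<Sum>k\<in>K. 1 / k) / 2 * card ?G
      \<le> (\<Sum>E\<in>?G. \<Sum>k\<in>K. card (cycles {..<n} E k) / k)" .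
  have "(\<Sum>E\<in>?G. \<Sum>k\<in>K. \<Sum>q<L. real (card (ears {..<n} E k q)))
      = (\<Sum>k\<in>K. \<Sum>E\<in>?G. \<Sum>q<L. real (card (ears {..<n} E k q)))"
    by (rule sum.swap)
  also have "\<dots> = (\<Sum>k\<in>K. \<Sum>q<L. \<Sum>E\<in>?G. real (card (ears {..<n} E k q)))"
    by (intro sum.cong refl sum.swap)
  also have "\<dots> \<le> (\<Sum>k\<in>K. \<Sum>q<L. L / n * card ?G)"
  proof (intro sum_mono)
    fix k q assume k: "k \<in> K"
    have "(\<Sum>E\<in>?G. real (card (ears {..<n} E k q)))
        \<le> k * n ^ (k + q) * ?p ^ (k + q + 1) * card ?G"
      using sum_card_ears_le[OF m, of k q] K[OF k] by simp
    \<comment> \<open>The surplus edge leaves a lone factor \<open>?p\<close>, at most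
      \<open>1 / n\<close>, beside powers of \<open>n * ?p\<close>, which are at most 1.\<close>
    also have "\<dots> = k * ((n * ?p) ^ (k + q) * ?p) * card ?G"
      by (simp add: power_mult_distrib power_divide mult_ac)
    also have "\<dots> \<le> L * (1 * (1 / n)) * card ?G"
    proof (intro mult_right_mono mult_mono)
      show "(n * ?p) ^ (k + q) \<le> 1" using np by (intro power_le_one) auto
      show "?p \<le> 1 / n" using np \<open>n > 0\<close> by (simp add: field_simps)
    qed (use K[OF k] in auto)
    finally show "(\<Sum>E\<in>?G. real (card (ears {..<n} E k q))) \<le> L / n * card ?G" by simp
  qed
  also have "\<dots> = card K * (real L ^ 2 / n * card ?G)" by (simp add: power2_eq_square)
  also have "\<dots> \<le> L * (real L ^ 2 / n * card ?G)"
    using cardK by (intro mult_right_mono) auto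
  also have "\<dots> = real (L ^ 3) / n * card ?G" by (simp add: power2_eq_square power3_eq_cube)
  also have "\<dots> \<le> 1 * real (card ?G)"
  proof (intro mult_right_mono)
    have "real (L ^ 3) \<le> real n" using L(1) by (rule of_nat_mono)
    then show "real (L ^ 3) / n \<le> 1" using \<open>n > 0\<close> by (simp only: divide_le_eq_1_pos of_nat_0_less_iff)
  qed simp
  finally have ear: "(\<Sum>E\<in>?G. \<Sum>k\<in>K. \<Sum>q<L. real (card (ears {..<n} E k q))) \<le> card ?G" by simp
  have "((\<Sum>k\<in>K. 1 / k) / 2 - 1) * card ?G
      \<le> (\<Sum>E\<in>?G. \<Sum>k\<in>K. card (cycles {..<n} E k) / k)
        - (\<Sum>E\<in>?G. \<Sum>k\<in>K. \<Sum>q<L. real (card (ears {..<n} E k q)))"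
    using cyc ear by (simp only: left_diff_distrib mult_1)
  also have "\<dots> \<le> (\<Sum>E\<in>?G. 2 * (real m - max_cut {..<n} E))"
    using sum_mono[OF pointwise] by (simp only: sum_subtractf)
  also have "\<dots> = 2 * (m - f_cut n m) * card ?G"
    using edges_minus_f_cut[OF m] by (simp only: sum_distrib_left[symmetric] mult.assoc)
  finally show ?thesis using pos by simp
qed

text \<open>Telescoping: from \<open>2 * J + 3\<close> to \<open>2 * J + 5\<close> the logarithm
  grows by at most \<open>2 / (2 * J + 3)\<close>, by \<open>ln t \<le> t - 1\<close>.\<close>

lemma sum_odd_reciprocals_ge:
  "(ln (real (2 * J + 3)) - ln 3) / 2 \<le> (\<Sum>k\<in>(\<lambda>j. 2 * j + 3) ` {..<J}. 1 / real k)"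
proof -
  have "(\<Sum>k\<in>(\<lambda>j. 2 * j + 3) ` {..<J}. 1 / real k) = (\<Sum>j<J. 1 / real (2 * j + 3))"
    by (subst sum.reindex) (auto simp: inj_on_def)
  also have "\<dots> \<ge> (ln (real (2 * J + 3)) - ln 3) / 2"
  proof (induction J)
    case (Suc J)
    have "ln (real (2 * Suc J + 3) / real (2 * J + 3)) \<le> real (2 * Suc J + 3) / real (2 * J + 3) - 1"
      by (rule ln_le_minus_one) simp
    also have "\<dots> = 2 / real (2 * J + 3)" by (simp add: field_simps)
    finally have "ln (real (2 * Suc J + 3)) - ln (real (2 * J + 3)) \<le> 2 / real (2 * J + 3)"
      by (simp add: ln_div)
    then show ?case using Suc by simp
  qed simp
  finally show ?thesis .
qed

text \<open>Explicit bounds for a single \<open>n\<close>. The assumption \<open>nx\<close> says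
  that \<open>x\<close> is at least \<open>n powr (-1/3)\<close>; the number 32768 is
  \<open>32 ^ 3\<close>, which settles \<open>32 * L ^ 2 \<le> n\<close> when
  \<open>L \<le> 32\<close>.\<close>

lemma f_cut_bounds:
  fixes x :: real
  assumes n: "n \<ge> 32768" and x: "0 < x" "x < 1 / 2" and nx: "x ^ 3 * n \<ge> 1"
  defines "m \<equiv> nat \<lfloor>(1 / 2 - x) * real n\<rfloor>"
  shows "ln (1 / x) / 8 - 1 \<le> m - f_cut n m" "m - f_cut n m \<le> ln (1 / x)"
proof -
  have m1: "real m \<le> (1 / 2 - x) * n" and m2: "(1 / 2 - x) * n - 1 \<le> real m"
    using x unfolding m_def by (simp_all add: of_nat_nat)
  have "x ^ 3 \<le> x" using x power_decreasing[of 1 3 x] by simp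
  then have xn: "1 \<le> x * n" using nx mult_right_mono[of "x ^ 3" x "real n"] by linarith
  have N: "real (n choose 2) = real n * (real n - 1) / 2" by (rule real_choose_2)
  have mn: "real m \<le> real n / 2" using m1 x mult_right_mono[of "1 / 2 - x" "1 / 2" "real n"] by simp
  also have "real n / 2 \<le> real (n choose 2)" unfolding N using n by (simp add: field_simps)
  finally have mN: "m \<le> n choose 2" by simp
  \<comment> \<open>Weakening \<open>1 - 2 * x\<close> to \<open>1 - x\<close> absorbs the passage
    from \<open>n\<close> to \<open>n - 1\<close>, because \<open>x * n\<close> is at least
    1.\<close>
  have "real m * 2 \<le> (1 - x) * (real n - 1)"
    using m1 xn x by (simp add: algebra_simps)
  moreover have "n * (m / (n choose 2)) = real m * 2 / (real n - 1)"
    unfolding N using n by (simp add: field_simps)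
  ultimately have np: "n * (m / (n choose 2)) \<le> 1 - x" using n by (simp add: divide_le_eq)
  show "m - f_cut n m \<le> ln (1 / x)" using mN x np by (intro edges_minus_f_cut_le) auto
  \<comment> \<open>The lengths are the \<open>J\<close> odd numbers from 3 to
    \<open>2 * J + 1\<close>, so \<open>L\<close> is about \<open>1 / (8 * x)\<close>. For
    \<open>J = 0\<close> there are none, and \<open>L = 0\<close> keeps \<open>L \<le> m\<close>
    true even if \<open>m = 0\<close>.\<close>
  define J where "J = nat \<lfloor>1 / (16 * x)\<rfloor>"
  define K where "K = (\<lambda>j. 2 * j + 3) ` {..<J}"
  define L where "L = (if J = 0 then 0 else 2 * J + 1)"
  have J1: "real J \<le> 1 / (16 * x)" and J2: "1 / (16 * x) < real J + 1"
    using x unfolding J_def by (simp_all add: of_nat_nat)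
  have Lx: "L * x \<le> 3 / 16"
  proof (cases "J = 0")
    case False
    then have "real L \<le> 3 * real J" by (simp add: L_def)
    also have "\<dots> \<le> 3 * (1 / (16 * x))" using J1 by (rule mult_left_mono) simp
    finally show ?thesis using x by (simp add: field_simps)
  qed (simp add: L_def)
  have "(L * x) ^ 3 \<le> 1 ^ 3" using Lx x by (intro power_mono) auto
  also have "\<dots> \<le> x ^ 3 * n" using nx by simp
  finally have "real (L ^ 3) \<le> real n" using x by (simp add: power_mult_distrib)
  then have L3: "L ^ 3 \<le> n" by (simp only: of_nat_le_iff)
  have L32: "32 * L ^ 2 \<le> n"
  proof (cases "L \<le> 32")
    case True
    then have "L ^ 2 \<le> 32 ^ 2" by (intro power_mono) auto
    with n show ?thesis by simp
  next
    case False
    then have "32 * L ^ 2 \<le> L * L ^ 2" by (intro mult_right_mono) auto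
    also have "\<dots> = L ^ 3" by (simp add: power2_eq_square power3_eq_cube)
    finally show ?thesis using L3 by simp
  qed
  have J0: "x \<le> 1 / 16" if "J \<noteq> 0"
  proof -
    have "1 \<le> real J" using that by simp
    with J1 have "1 \<le> 1 / (16 * x)" by linarith
    with x show ?thesis by (simp add: field_simps)
  qed
  have Lm: "L \<le> m"
  proof (cases "J = 0")
    case False
    then have "L \<ge> 1" by (simp add: L_def)
    then have "L ^ 1 \<le> L ^ 2" by (intro power_increasing) auto
    with L32 have "32 * L \<le> n" by simp
    then have "32 * real L \<le> real n" by linarith
    \<comment> \<open>The constant is \<open>1 / 2 - 1 / 16\<close>. As \<open>L\<close> is at most
      \<open>n / 32\<close>, ample room is left for the rounding in \<open>m\<close>.\<close>
    moreover have "7 / 16 * real n \<le> (1 / 2 - x) * real n"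
      using J0[OF False] by (intro mult_right_mono) auto
    moreover have "32768 \<le> real n" using n by simp
    ultimately have "real L \<le> real m" using m2 by linarith
    then show ?thesis by simp
  qed (simp add: L_def)
  have K: "odd k \<and> 3 \<le> k \<and> k \<le> L" if "k \<in> K" for k using that by (auto simp: K_def L_def)
  \<comment> \<open>The target for the base is \<open>1 - 1 / (2 * k)\<close>, whose
    \<open>k\<close>-th power is at least \<open>1 / 2\<close> by Bernoulli's inequality.\<close>
  have half: "1 / 2 \<le> ((real n - k) * ((real m - k) / (n choose 2))) ^ k" if k: "k \<in> K" for k
  proof -
    have k': "3 \<le> k" "k \<le> L" using K[OF k] by auto
    have "k * x \<le> L * x" using k'(2) x by (intro mult_right_mono) auto
    then have kx: "k * x \<le> 3 / 16" using Lx by linarith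
    have "32 * k ^ 2 \<le> 32 * L ^ 2" using k'(2) by (intro mult_left_mono power_mono) auto
    then have "32 * k ^ 2 \<le> n" using L32 by (rule order_trans)
    then have "real (32 * k ^ 2) \<le> real n" by (rule of_nat_mono)
    then have kn: "32 * real k ^ 2 \<le> n" by simp
    have "real k * (3 * k + 2) \<le> real k * (4 * k)" using k' by (intro mult_left_mono) auto
    also have "\<dots> \<le> n / 8" using kn by (simp add: power2_eq_square)
    finally have a: "real k * (3 * k + 2) \<le> n / 8" .
    \<comment> \<open>The total deficit of the base: \<open>2 * x\<close> from the density,
      \<open>(2 * k + 2) / n\<close> from rounding and from the edges already used,
      \<open>k / n\<close> from distinctness of vertices. Times \<open>k\<close> it is at most
      \<open>3 / 8 + 1 / 8\<close>.\<close>
    have b: "2 * x + (3 * k + 2) / n \<le> 1 / (2 * k)"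
    proof -
      have "(2 * x + (3 * k + 2) / n) * k = 2 * (k * x) + real k * (3 * k + 2) / n"
        by (simp add: algebra_simps)
      also have "\<dots> \<le> 2 * (3 / 16) + (n / 8) / n"
        using a kx by (intro add_mono mult_left_mono divide_right_mono) auto
      also have "\<dots> = 1 / 2" using n by simp
      finally show ?thesis using k' by (simp add: field_simps)
    qed
    have km: "real k \<le> m" using k'(2) Lm by simp
    then have kn': "real k \<le> n" using mn by simp
    have "1 - 1 / (2 * k) \<le> 1 - (2 * x + (3 * k + 2) / n)" using b by simp
    also have "\<dots> \<le> (1 - k / n) * (1 - 2 * x - (2 * k + 2) / n)"
    proof -
      have gen: "1 - (2 * x + (a + b)) \<le> (1 - a) * (1 - 2 * x - b)"
        if "0 \<le> a * (2 * x + b)" for a b :: real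
        using that by (simp add: algebra_simps)
      have "0 \<le> k / n * (2 * x + (2 * k + 2) / n)" using x by simp
      then have "1 - (2 * x + (k / n + (2 * k + 2) / n)) \<le> (1 - k / n) * (1 - 2 * x - (2 * k + 2) / n)"
        by (rule gen)
      moreover have "k / n + (2 * k + 2) / n = (3 * k + 2) / n"
        by (simp add: add_divide_distrib[symmetric])
      ultimately show ?thesis by (simp only:)
    qed
    also have "\<dots> \<le> (1 - k / n) * (2 * (real m - k) / n)"
    proof (rule mult_left_mono)
      have "(1 - 2 * x - (2 * k + 2) / n) * n = 2 * ((1 / 2 - x) * n - 1 - k)"
        using n by (simp add: left_diff_distrib)
      also have "\<dots> \<le> 2 * (real m - k)" using m2 by simp
      finally show "1 - 2 * x - (2 * k + 2) / n \<le> 2 * (real m - k) / n"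
        using n by (simp add: le_divide_eq)
      show "0 \<le> 1 - k / n" using kn' n by simp
    qed
    also have "\<dots> = (real n - k) * ((real m - k) / (n * n / 2))"
      using n by (simp add: field_simps)
    also have "\<dots> \<le> (real n - k) * ((real m - k) / (n choose 2))"
      unfolding N using kn' km n
      by (intro mult_left_mono divide_left_mono) (auto intro!: mult_left_mono)
    finally have c: "1 + (- 1 / (2 * k)) \<le> (real n - k) * ((real m - k) / (n choose 2))" by simp
    have "1 / 2 = 1 + k * (- 1 / (2 * real k))" using k' by simp
    also have "\<dots> \<le> (1 + (- 1 / (2 * real k))) ^ k"
      using k' by (intro Bernoulli_inequality) (simp add: field_simps)
    also have "\<dots> \<le> ((real n - k) * ((real m - k) / (n choose 2))) ^ k"
      using c k' by (intro power_mono) (auto simp: field_simps)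
    finally show ?thesis .
  qed
  have "(\<Sum>k\<in>K. 1 / k) / 2 - 1 \<le> 2 * (m - f_cut n m)"
  proof (rule edges_minus_f_cut_ge[OF mN])
    show "n * (m / (n choose 2)) \<le> 1" using np x by simp
  qed (use n K L3 Lm half in \<open>auto simp: K_def\<close>)
  moreover have "(ln (real (2 * J + 3)) - ln 3) / 2 \<le> (\<Sum>k\<in>K. 1 / k)"
    unfolding K_def by (rule sum_odd_reciprocals_ge)
  moreover have "ln (1 / x) - ln 8 \<le> ln (real (2 * J + 3))"
  proof -
    \<comment> \<open>\<open>2 * J + 3\<close> exceeds \<open>2 * (J + 1)\<close>, which is greater
      than \<open>1 / (8 * x)\<close>.\<close>
    have "1 / x / 8 \<le> real (2 * J + 3)" using J2 x by (simp add: field_simps)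
    then have "ln (1 / x / 8) \<le> ln (real (2 * J + 3))" using x by (subst ln_le_cancel_iff) auto
    then show ?thesis using x by (subst (asm) ln_div) auto
  qed
  \<comment> \<open>The two losses, \<open>ln 8\<close> from the choice of \<open>J\<close> and
    \<open>ln 3\<close> from the start of the odd sum, enter the final bound divided by 8. Being at
    most 4 together, they cost \<open>1 / 2\<close>, and the ears cost the other
    \<open>1 / 2\<close>.\<close>
  moreover have "ln 8 + ln 3 \<le> (4 :: real)"
  proof -
    have "ln 8 + ln 3 = ln (24 :: real)" using ln_mult[of 8 "3 :: real"] by simp
    also have "\<dots> = 3 * ln 2 + ln (3 :: real)"
      using ln_mult[of 8 "3 :: real"] ln_realpow[of "2 :: real" 3] by simp
    also have "\<dots> \<le> 3 * (25 / 36) + (3 / 2 - 1 + 25 / 36)"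
      using ln2_le_25_over_36 ln_le_minus_one[of "3 / 2 :: real"] ln_div[of 3 "2 :: real"] by simp
    finally show ?thesis by simp
  qed
  ultimately show "ln (1 / x) / 8 - 1 \<le> m - f_cut n m" by argo
qed

theorem theorem19:
  fixes \<epsilon> :: "nat \<Rightarrow> real" and m :: "nat \<Rightarrow> nat"
  assumes eps_lower: "(\<lambda>n. real n powr (-1/3) / \<epsilon> n) \<longlonglongrightarrow> 0"
    and eps_range: "\<forall>\<^sub>F n in sequentially. 0 < \<epsilon> n \<and> \<epsilon> n < 1/2"
    and m_def: "\<And>n. m n = nat \<lfloor>(1/2 - \<epsilon> n) * real n\<rfloor>"
  shows "\<exists>g h :: nat \<Rightarrow> real.
           g \<in> \<Theta>(\<lambda>n. ln (1 / \<epsilon> n)) \<and> h \<in> \<Theta>(\<lambda>_. 1) \<and>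
           (\<forall>\<^sub>F n in sequentially. 0 \<le> g n \<and> 0 \<le> h n \<and>
              f_cut n (m n) = real (m n) - g n + h n)"
proof -
  define g where "g n = real (m n) - f_cut n (m n) + 1" for n
  have "\<forall>\<^sub>F n in sequentially. real n powr (-1/3) / \<epsilon> n < 1"
    using eps_lower by (rule order_tendstoD) simp
  with eps_range eventually_ge_at_top[of 32768]
  have ev: "\<forall>\<^sub>F n in sequentially. ln (1 / \<epsilon> n) / 8 \<le> g n \<and> g n \<le> 3 * ln (1 / \<epsilon> n)
      \<and> 0 \<le> ln (1 / \<epsilon> n)"
  proof eventually_elim
    case (elim n)
    \<comment> \<open>Once the ratio is below 1, cubing gives the hypothesis
      \<open>x ^ 3 * n \<ge> 1\<close> of \<open>f_cut_bounds\<close>.\<close>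
    then have "real n powr (-1/3) \<le> \<epsilon> n" by (simp add: field_simps)
    then have "(real n powr (-1/3)) ^ 3 \<le> \<epsilon> n ^ 3" by (intro power_mono) auto
    moreover have "(real n powr (-1/3)) ^ 3 = real n powr (-1)"
      using elim(2) by (subst powr_power) auto
    then have "(real n powr (-1/3)) ^ 3 = 1 / real n"
      using elim(2) by (simp only: powr_minus_divide powr_one)
    ultimately have "1 / real n \<le> \<epsilon> n ^ 3" by linarith
    then have "\<epsilon> n ^ 3 * real n \<ge> 1" using elim(2) by (simp add: divide_le_eq)
    with elim have "ln (1 / \<epsilon> n) / 8 \<le> g n \<and> g n \<le> ln (1 / \<epsilon> n) + 1"
      using f_cut_bounds[of n "\<epsilon> n"] unfolding g_def m_def by auto
    \<comment> \<open>The logarithm stays away from 0 because \<open>\<epsilon> n < 1/2\<close>.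
      Being at least \<open>2 / 3\<close>, it absorbs the added 1 in \<open>g\<close>, which gives
      the constant 3.\<close>
    moreover have "ln 2 \<le> ln (1 / \<epsilon> n)"
      using elim by (subst ln_le_cancel_iff) (auto simp: field_simps)
    then have "2 / 3 \<le> ln (1 / \<epsilon> n)" using ln2_ge_two_thirds by linarith
    ultimately show ?case by linarith
  qed
  have "g \<in> \<Theta>(\<lambda>n. ln (1 / \<epsilon> n))"
  proof (rule bigthetaI)
    show "g \<in> O(\<lambda>n. ln (1 / \<epsilon> n))"
      using ev by (intro bigoI[of _ 3]) (auto elim!: eventually_mono)
    show "g \<in> \<Omega>(\<lambda>n. ln (1 / \<epsilon> n))"
      using ev by (intro landau_omega.bigI[of "1 / 8"]) (auto elim!: eventually_mono)
  qed
  moreover have "\<forall>\<^sub>F n in sequentially. 0 \<le> g n \<and> (0 :: real) \<le> 1 \<and>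
      f_cut n (m n) = real (m n) - g n + 1"
    using ev by eventually_elim (auto simp: g_def)
  ultimately show ?thesis by (intro exI[of _ g] exI[of _ "\<lambda>_. 1"]) auto
qed

end
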